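(* For the hypergeometric-Mittag-Leffler functions ${}_{{}_2F_1}E_{(\alpha,\beta)}(a_1,a_2;b_1;u)$, defined umbrally by ${}_{{}_2F_1}E_{(\alpha,\beta)}(a_1,a_2;b_1;u)=E_{\alpha,\beta}(u\,{}_2\hat\chi_1)\Phi_0$, the following series expansion holds true: $$ {}_{{}_2F_1}E_{(\alpha,\beta)}(a_1,a_2;b_1;u)=\sum_{r=0}^{\infty}\frac{(a_1)_r(a_2)_r}{(b_1)_r\,\Gamma(\alpha r+\beta)}\,u^r,\qquad \alpha,\beta\in\mathbb{R}^{+},\quad u\in\mathbb{R}.$$
   Context: $(a)_r=\Gamma(a+r)/\Gamma(a)$ is the Pochhammer symbol. $E_{\alpha,\beta}(u)=\sum_{m=0}^{\infty}u^m/\Gamma(\alpha m+\beta)$ ($u\in\mathbb{R}$, $\alpha,\beta\in\mathbb{R}^+$) is the two-parameter Mittag-Leffler function. The umbral operators ${}_2\hat\chi_1$, $\hat c$, $\hat d_{(\alpha,\beta)}$ act on the corresponding vacua $\Phi_0,\zeta_0,\Psi_0$ by $${}_2\hat\chi_1^{\,r}\Phi_0=\frac{(a_1)_r(a_2)_r}{(b_1)_r},\qquad \hat c^{\,\mu}\zeta_0=\frac1{\Gamma(\mu+1)},\qquad \hat d_{(\alpha,\beta)}^{\,k}\Psi_0=\frac{\Gamma(k+1)}{\Gamma(\alpha k+\beta)} .$$ The Mittag-Leffler function has the umbral forms $E_{\alpha,\beta}(u)=\frac{\hat c^{\,\beta-1}}{1-\hat c^{\,\alpha}u}\zeta_0$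 and $E_{\alpha,\beta}(u)=e^{u\hat d_{(\alpha,\beta)}}\Psi_0$. Replacing $u$ by $u\,{}_2\hat\chi_1$ and acting on $\Phi_0$, the function ${}_{{}_2F_1}E_{(\alpha,\beta)}(a_1,a_2;b_1;u)$ correspondingly has the two umbral forms $$\frac{\hat c^{\,\beta-1}}{1-\hat c^{\,\alpha}u\,{}_2\hat\chi_1}\Phi_0\zeta_0\qquad\text{and}\qquad e^{u\,{}_2\hat\chi_1\hat d_{(\alpha,\beta)}}\Psi_0\Phi_0 .$$ *)

theory Defs
  imports "HOL-Analysis.Analysis"
begin

definition mittag_leffler :: "real \<Rightarrow> real \<Rightarrow> real \<Rightarrow> real" where
  "mittag_leffler \<alpha> \<beta> u = (\<Sum>m. u ^ m / Gamma (\<alpha> * real m + \<beta>))"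

text \<open>
  Umbral operators are realised in the usual way: the operator is a unit shift acting on the
  vacuum, which is a function, and an umbral expression is read off at the argument 0.
  Only non-negative integer powers of the operator occur here, so the vacuum is a sequence.
  The library function \<^const>\<open>pochhammer\<close> equals \<open>\<Gamma>(a + r) / \<Gamma>(a)\<close> whenever the latter
  is defined (\<open>pochhammer_Gamma\<close>), and extends it to the poles of \<open>\<Gamma>\<close>.
\<close>

definition chi_op :: "(nat \<Rightarrow> complex) \<Rightarrow> nat \<Rightarrow> complex" where
  "chi_op \<phi> = (\<lambda>n. \<phi> (Suc n))"

definition vacuum_2_1 :: "complex \<Rightarrow> complex \<Rightarrow> complex \<Rightarrow> nat \<Rightarrow> complex" where
  "vacuum_2_1 a1 a2 b1 n = pochhammer a1 n * pochhammer a2 n / pochhammer b1 n"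

lemma chi_op_vacuum:
  "(chi_op ^^ r) (vacuum_2_1 a1 a2 b1) 0 = pochhammer a1 r * pochhammer a2 r / pochhammer b1 r"
proof -
  have "(chi_op ^^ r) \<phi> n = \<phi> (n + r)" for \<phi> :: "nat \<Rightarrow> complex" and n
    by (induction r arbitrary: n) (simp_all add: chi_op_def)
  then show ?thesis
    by (simp add: vacuum_2_1_def)
qed

definition scale_op :: "real \<Rightarrow> ((nat \<Rightarrow> complex) \<Rightarrow> nat \<Rightarrow> complex) \<Rightarrow> (nat \<Rightarrow> complex) \<Rightarrow> nat \<Rightarrow> complex" where
  "scale_op u T \<phi> = (\<lambda>n. of_real u * T \<phi> n)"

text \<open>
  The terms of the umbral expression \<open>f(T) \<phi>\<^sub>0\<close>: the function \<open>f\<close> of the operator \<open>T\<close> is given by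
  the Maclaurin series of \<open>f\<close>, which acts termwise on the vacuum \<open>\<phi>\<close>.
  The resulting series need not converge, even if \<open>f\<close> is entire.
\<close>

definition umbral_terms ::
  "(real \<Rightarrow> real) \<Rightarrow> ((nat \<Rightarrow> complex) \<Rightarrow> nat \<Rightarrow> complex) \<Rightarrow> (nat \<Rightarrow> complex) \<Rightarrow> nat \<Rightarrow> complex" where
  "umbral_terms f T \<phi> m = of_real ((deriv ^^ m) f 0 / fact m) * (T ^^ m) \<phi> 0"

definition umbral_value ::
  "(real \<Rightarrow> real) \<Rightarrow> ((nat \<Rightarrow> complex) \<Rightarrow> nat \<Rightarrow> complex) \<Rightarrow> (nat \<Rightarrow> complex) \<Rightarrow> complex" where
  "umbral_value f T \<phi> = (\<Sum>m. umbral_terms f T \<phi> m)"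

definition hyp_mittag_leffler ::
  "real \<Rightarrow> real \<Rightarrow> complex \<Rightarrow> complex \<Rightarrow> complex \<Rightarrow> real \<Rightarrow> complex" where
  "hyp_mittag_leffler \<alpha> \<beta> a1 a2 b1 u =
     umbral_value (mittag_leffler \<alpha> \<beta>) (scale_op u chi_op) (vacuum_2_1 a1 a2 b1)"

end

theory Submission
  imports Defs
begin

text \<open>
  Each term of the umbral series is a Maclaurin coefficient of the Mittag-Leffler function times
  \<open>u ^ r\<close> times a vacuum value, so everything rests on identifying that Maclaurin coefficient as
  \<open>1 / \<Gamma>(\<alpha> r + \<beta>)\<close>. For this the defining series only has to converge near 0, which
  holds because \<open>1 / \<Gamma>\<close> is bounded on the positive half-line.
\<close>

lemma Gamma_pos_bounded_below:
  obtains c :: real where "c > 0" and "\<And>x. x > 0 \<Longrightarrow> c \<le> Gamma x"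
proof -
  \<comment> \<open>\<open>Gamma\<close> has a pole at 0, but its reciprocal \<open>rGamma\<close>
    is continuous on the whole compact interval, so an upper bound K there gives the lower bound
    \<open>inverse K\<close> for \<open>Gamma\<close>.\<close>
  have "bounded (rGamma ` {0..2::real})"
    by (intro compact_imp_bounded compact_continuous_image continuous_on_rGamma) simp
  then obtain K where K: "K > 0" "\<And>x. x \<in> {0..2} \<Longrightarrow> norm (rGamma (x::real)) \<le> K"
    by (metis bounded_pos imageI)
  \<comment> \<open>\<open>\<Gamma>(x + 1) = x \<Gamma>(x) \<ge> \<Gamma>(x)\<close> for \<open>x \<ge> 1\<close> propagates the bound upwards from \<open>{0<..2}\<close>.\<close>
  have bound: "inverse K \<le> Gamma x" if "x > 0" "x \<le> real n + 2" for x :: real and n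
    using that
  proof (induction n arbitrary: x)
    case 0
    then have "inverse (Gamma x) \<le> K"
      using K(2)[of x] by (simp add: rGamma_inverse_Gamma)
    then show ?case
      using 0 K(1) le_imp_inverse_le[of "inverse (Gamma x)" K] by simp
  next
    case (Suc n)
    show ?case
    proof (cases "x \<le> 2")
      case True
      then show ?thesis
        using Suc by simp
    next
      case False
      then have "inverse K \<le> Gamma (x - 1)"
        using Suc by (intro Suc.IH) auto
      also have "\<dots> \<le> (x - 1) * Gamma (x - 1)"
        using False mult_right_mono[of 1 "x - 1" "Gamma (x - 1)"] by (simp add: less_imp_le)
      also have "\<dots> = Gamma x"
        using Gamma_plus1[of "x - 1"] False by (force elim!: nonpos_Ints_cases)
      finally show ?thesis .
    qed
  qed
  show ?thesis
  proof (rule that[of "inverse K"])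
    fix x :: real
    assume "x > 0"
    then show "inverse K \<le> Gamma x"
      using bound[of x "nat \<lceil>x\<rceil>"] by linarith
  qed (use K(1) in simp)
qed

text \<open>Comparison with a geometric series. At \<alpha> = 0 the series is itself geometric up to
  a constant factor, so the radius 1 is sharp there.\<close>

lemma mittag_leffler_sums:
  assumes "\<alpha> \<ge> 0" "\<beta> > 0" "\<bar>u\<bar> < 1"
  shows "(\<lambda>m. u ^ m / Gamma (\<alpha> * real m + \<beta>)) sums mittag_leffler \<alpha> \<beta> u"
proof -
  obtain c :: real where c: "c > 0" "\<And>x. x > 0 \<Longrightarrow> c \<le> Gamma x"
    using Gamma_pos_bounded_below by blast
  have "summable (\<lambda>m. u ^ m / Gamma (\<alpha> * real m + \<beta>))"
  proof (rule summable_comparison_test')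
    show "summable (\<lambda>m. \<bar>u\<bar> ^ m / c)"
      using assms(3) by (intro summable_divide summable_geometric) simp
    fix m :: nat
    have "\<alpha> * real m + \<beta> > 0"
      using assms by (simp add: add_nonneg_pos)
    from c(2)[OF this] show "norm (u ^ m / Gamma (\<alpha> * real m + \<beta>)) \<le> \<bar>u\<bar> ^ m / c"
      using c(1) by (auto simp: power_abs intro!: divide_left_mono)
  qed
  then show ?thesis
    by (simp add: mittag_leffler_def summable_sums)
qed

text \<open>Differentiation near 0 matches formal differentiation, and n formal derivatives move
  coefficient n, times n!, to the constant term.\<close>

lemma has_fps_expansion_imp_higher_deriv_0:
  fixes f :: "'a :: {banach, real_normed_field} \<Rightarrow> 'a"
  assumes "f has_fps_expansion F"
  shows "(deriv ^^ n) f 0 = fact n * fps_nth F n"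
proof -
  have "(deriv ^^ n) f has_fps_expansion (fps_deriv ^^ n) F"
    by (induction n) (simp_all add: assms has_fps_expansion_deriv)
  \<comment> \<open>A property holding eventually in \<open>nhds 0\<close> holds at 0
    itself.\<close>
  then have "(deriv ^^ n) f 0 = fps_nth ((fps_deriv ^^ n) F) 0"
    by (auto simp: has_fps_expansion_def eval_fps_at_0 dest: eventually_nhds_x_imp_x)
  then show ?thesis
    by (simp add: fps_0th_higher_deriv)
qed

lemma mittag_leffler_has_fps_expansion:
  assumes "\<alpha> \<ge> 0" "\<beta> > 0"
  shows "mittag_leffler \<alpha> \<beta> has_fps_expansion Abs_fps (\<lambda>m. 1 / Gamma (\<alpha> * real m + \<beta>))"
proof (rule has_fps_expansionI)
  have "eventually (\<lambda>u::real. u \<in> ball 0 1) (nhds 0)"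
    by (intro eventually_nhds_in_open) auto
  then show "eventually (\<lambda>u. (\<lambda>m. fps_nth (Abs_fps (\<lambda>m. 1 / Gamma (\<alpha> * real m + \<beta>))) m * u ^ m)
               sums mittag_leffler \<alpha> \<beta> u) (nhds 0)"
    by eventually_elim (use mittag_leffler_sums[OF assms] in simp)
qed

lemma higher_deriv_mittag_leffler_0:
  assumes "\<alpha> \<ge> 0" "\<beta> > 0"
  shows "(deriv ^^ m) (mittag_leffler \<alpha> \<beta>) 0 / fact m = 1 / Gamma (\<alpha> * real m + \<beta>)"
  by (simp add: has_fps_expansion_imp_higher_deriv_0[OF mittag_leffler_has_fps_expansion[OF assms]])

text \<open>The scalar factor commutes with the shift.\<close>

lemma funpow_scale_op_chi_op:
  "(scale_op u chi_op ^^ m) \<phi> n = of_real u ^ m * (chi_op ^^ m) \<phi> n"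
  by (induction m arbitrary: n) (simp_all add: scale_op_def chi_op_def)

text \<open>Where \<open>pochhammer b1 r\<close> vanishes, both sides are 0 because x / 0 =
  0.\<close>

lemma umbral_terms_mittag_leffler:
  assumes "\<alpha> \<ge> 0" "\<beta> > 0"
  shows "umbral_terms (mittag_leffler \<alpha> \<beta>) (scale_op u chi_op) (vacuum_2_1 a1 a2 b1) r =
           pochhammer a1 r * pochhammer a2 r
             / (pochhammer b1 r * of_real (Gamma (\<alpha> * real r + \<beta>))) * of_real u ^ r"
  by (simp add: umbral_terms_def higher_deriv_mittag_leffler_0[OF assms]
      funpow_scale_op_chi_op chi_op_vacuum mult_ac)

theorem theorem1:
  fixes \<alpha> \<beta> u :: real and a1 a2 b1 :: complex
  assumes "\<alpha> > 0" and "\<beta> > 0"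
  shows "hyp_mittag_leffler \<alpha> \<beta> a1 a2 b1 u =
           (\<Sum>r. pochhammer a1 r * pochhammer a2 r
                  / (pochhammer b1 r * of_real (Gamma (\<alpha> * real r + \<beta>))) * of_real u ^ r)
       \<and> (\<forall>r. umbral_terms (mittag_leffler \<alpha> \<beta>) (scale_op u chi_op) (vacuum_2_1 a1 a2 b1) r =
           pochhammer a1 r * pochhammer a2 r
                  / (pochhammer b1 r * of_real (Gamma (\<alpha> * real r + \<beta>))) * of_real u ^ r)"
  \<comment> \<open>The two series agree term by term, so their \<open>suminf\<close> values
    coincide even when the series diverges; the second conjunct records the termwise
    identity.\<close>
  using assms
  by (simp add: hyp_mittag_leffler_def umbral_value_def umbral_terms_mittag_leffler)

end
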